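(* Let $X=\{1,2,\ldots,d\}$ and let $P$ be a symmetric set of permutations of $X$ with $d=|P|^2$. Let $S_P=\{s_{(\pi,\tau)}:\pi,\tau\in P\}=\{s_1,\ldots,s_d\}$ be the generating set, defined by the wreath recursion given in the context, of the self-similar group $G_P=\langle S_P\rangle$ acting on $X^*$, and let $\Gamma_n$ ($n\ge 1$) be the action graph of $S_P$ on $X^n$. Let $\Gamma$ be the graph of the action of $P$ on $X$. Then for every $n\ge 1$, $$\Gamma_{n+1}=\Gamma_n\,ⓩ\,\Gamma ,$$ where $ⓩ$ denotes the zig-zag product, the vertex $(x,v)\in X\times X^n$ of the product is identified with $xv\in X^{n+1}$, and the edges of $\Gamma_n$ at each vertex $v\in X^n$ are labeled by the vertices of $\Gamma$ via $v[x]:=s_x(v)$, $x\in X$ (so the edge labeled $x$ at $v$ is labeled $\gamma(x)$ at $s_x(v)$, with $\gamma$ the involution of $X$ defined in the context).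
   Context: Graphs are regular, undirected, and may have loops and multiple edges. A set of permutations is symmetric if it is closed under inverses. Action graphs: if a finite family $S$ of generators, closed under inverses, acts on a set $V$, the action graph has vertex set $V$ and, for every $s\in S$ and $v\in V$, an edge between $v$ and $s(v)$; the edge given by $s$ at $v$ is the same undirected edge as the one given by $s^{-1}$ at $s(v)$, so the graph is $|S|$-regular (generators are counted as formal symbols). Equality of graphs is with multiplicities of edges. Wreath recursion: $X^*$ is the set of finite words over $X$. Choose an order $S_P=\{s_1,\ldots,s_d\}$ on the $|P|^2=d$ formal symbols $s_{(\pi,\tau)}$, $\pi,\tau\in P$. Let $\gamma$ be the permutation of $X$ given by: if $s_x=s_{(\pi,\tau)}$ then $s_{\gamma(x)}=s_{(\tau^{-1},\pi^{-1})}$; it satisfies $\gamma=\gamma^{-1}$. The symbols act on $X^*$ (left actions, fixing the empty word, preserving length) by the recursive rule $$s_{(\pi,\tau)}(xv)=\tau(\gamma(\pi(x)))\,s_{\pi(x)}(v),\qquad x\in X,\ v\in X^*.$$ These are invertible transformations, $s_{(\pi,\tau)}^{-1}=s_{(\tau^{-1},\pi^{-1})}$ (that is, $s_x^{-1}=s_{\gamma(x)}$), and $G_P$ is the group they generate under composition. Zig-zag product: let $\mathcal G$ be a $D$-regular graph and $\Gamma$ a $\delta$-regular graph on $D$ vertices. The edges at each vertex of $\mathcal G$ are labeled by the vertices of $\Gamma$ in one-to-one fashion; $v[x]$ denotes the neighbor of $v$ along the edge labeled $x$ at $v$. The zig-zag product $\mathcal G\,ⓩ\,\Gamma$ is the $\delta^2$-regular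 graph with vertex set $V(\Gamma)\times V(\mathcal G)$ whose edges are as follows: for every edge $x - x'$ of $\Gamma$, the edge of $\mathcal G$ joining $v$ and $u=v[x']$ that is labeled $x'$ at $v$ and, say, $y'$ at $u$, and every edge $y' - y$ of $\Gamma$, there is an edge between $(x,v)$ and $(y,u)$. The product depends on the chosen labeling. *)

theory Defs
  imports Main "HOL-Combinatorics.Permutations"
begin

text \<open>
  An undirected multigraph is given by its darts: an edge between \<open>u\<close> and \<open>v\<close> is an
  orbit \<open>{e, flip e}\<close> with \<open>e\<close> starting at \<open>u\<close> and \<open>flip e\<close> starting at \<open>v\<close>. Fixed points of
  \<open>flip\<close> are allowed: they are loops that contribute 1 to the degree (as produced by a generator
  that is its own formal inverse), whereas a loop with two darts contributes 2.
\<close>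

record ('v, 'e) mgraph =
  verts :: "'v set"
  darts :: "'e set"
  origin :: "'e \<Rightarrow> 'v"
  flip :: "'e \<Rightarrow> 'e"

definition multigraph :: "('v, 'e) mgraph \<Rightarrow> bool" where
  "multigraph G \<longleftrightarrow>
     (\<forall>e\<in>darts G. origin G e \<in> verts G \<and> flip G e \<in> darts G \<and> flip G (flip G e) = e)"

definition terminus :: "('v, 'e) mgraph \<Rightarrow> 'e \<Rightarrow> 'v" where
  "terminus G e = origin G (flip G e)"

definition darts_at :: "('v, 'e) mgraph \<Rightarrow> 'v \<Rightarrow> 'e set" where
  "darts_at G v = {e \<in> darts G. origin G e = v}"

definition regular :: "nat \<Rightarrow> ('v, 'e) mgraph \<Rightarrow> bool" where
  "regular k G \<longleftrightarrow> multigraph G \<and> (\<forall>v\<in>verts G. finite (darts_at G v) \<and> card (darts_at G v) = k)"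

text \<open>
  Equality of graphs on the same vertex set, counting edges with multiplicity: the edges
  correspond bijectively, with the same end points and the same kind of loops. The names of
  the darts carry no information.
\<close>

definition graph_eq :: "('v, 'e) mgraph \<Rightarrow> ('v, 'f) mgraph \<Rightarrow> bool" where
  "graph_eq G H \<longleftrightarrow> verts G = verts H \<and>
     (\<exists>\<phi>. bij_betw \<phi> (darts G) (darts H) \<and>
          (\<forall>e\<in>darts G. origin H (\<phi> e) = origin G e \<and> flip H (\<phi> e) = \<phi> (flip G e)))"

definition rename_verts :: "('v \<Rightarrow> 'w) \<Rightarrow> ('v, 'e) mgraph \<Rightarrow> ('w, 'e) mgraph" where
  "rename_verts h G =
     \<lparr>verts = h ` verts G, darts = darts G, origin = h \<circ> origin G, flip = flip G\<rparr>"

text \<open>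
  The action graph of a family \<open>S\<close> of formal generators on \<open>V\<close>: \<open>i\<close> is the formal inversion on \<open>S\<close>,
  and the dart \<open>(s, v)\<close> goes from \<open>v\<close> to \<open>a s v\<close>.
\<close>

definition action_graph ::
    "'s set \<Rightarrow> ('s \<Rightarrow> 's) \<Rightarrow> ('s \<Rightarrow> 'v \<Rightarrow> 'v) \<Rightarrow> 'v set \<Rightarrow> ('v, 's \<times> 'v) mgraph" where
  "action_graph S i a V =
     \<lparr>verts = V, darts = S \<times> V, origin = snd, flip = (\<lambda>(s, v). (i s, a s v))\<rparr>"

text \<open>
  An edge labeling assigns to each dart \<open>e\<close> the label \<open>l e\<close> of its edge at the origin of \<open>e\<close>. The
  label of the same edge at the other end is \<open>l (flip G e)\<close>.
\<close>

definition edge_labeling :: "('v, 'e) mgraph \<Rightarrow> ('e \<Rightarrow> 'x) \<Rightarrow> 'x set \<Rightarrow> bool" where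
  "edge_labeling G l L \<longleftrightarrow> (\<forall>v\<in>verts G. bij_betw l (darts_at G v) L)"

definition neighbor :: "('v, 'e) mgraph \<Rightarrow> ('e \<Rightarrow> 'x) \<Rightarrow> 'v \<Rightarrow> 'x \<Rightarrow> 'v" where
  "neighbor G l v x = terminus G (THE e. e \<in> darts_at G v \<and> l e = x)"

text \<open>
  In the zig-zag product a dart is a path \<open>x - x'\<close> in \<open>H\<close>, \<open>v - u\<close> in \<open>G\<close>, \<open>y' - y\<close> in \<open>H\<close>, where the edge of
  \<open>G\<close> is labeled \<open>x'\<close> at \<open>v\<close> and \<open>y'\<close> at \<open>u\<close>. Traversing the path backwards gives the same edge.
\<close>

definition zigzag ::
    "('v, 'e) mgraph \<Rightarrow> ('e \<Rightarrow> 'x) \<Rightarrow> ('x, 'f) mgraph \<Rightarrow> ('x \<times> 'v, 'f \<times> 'e \<times> 'f) mgraph" where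
  "zigzag G l H =
     \<lparr>verts = verts H \<times> verts G,
      darts = {(a, e, b). a \<in> darts H \<and> e \<in> darts G \<and> b \<in> darts H \<and>
                          terminus H a = l e \<and> l (flip G e) = origin H b},
      origin = (\<lambda>(a, e, b). (origin H a, origin G e)),
      flip = (\<lambda>(a, e, b). (flip H b, flip G e, flip H a))\<rparr>"

text \<open>
  The pair \<open>(\<pi>, \<tau>)\<close> serves as the formal symbol \<open>s\<^bsub>(\<pi>,\<tau>)\<^esub>\<close>; a bijection \<open>s\<close> from \<open>{1..d}\<close> to the symbols
  is the chosen order on them.
\<close>

type_synonym symbol = "(nat \<Rightarrow> nat) \<times> (nat \<Rightarrow> nat)"

definition symbol_inv :: "symbol \<Rightarrow> symbol" where
  "symbol_inv = (\<lambda>(\<pi>, \<tau>). (inv \<tau>, inv \<pi>))"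

definition \<gamma> :: "nat \<Rightarrow> (nat \<Rightarrow> symbol) \<Rightarrow> nat \<Rightarrow> nat" where
  "\<gamma> d s x = (if x \<in> {1..d} then inv_into {1..d} s (symbol_inv (s x)) else x)"

fun act :: "nat \<Rightarrow> (nat \<Rightarrow> symbol) \<Rightarrow> symbol \<Rightarrow> nat list \<Rightarrow> nat list" where
  "act d s (\<pi>, \<tau>) [] = []"
| "act d s (\<pi>, \<tau>) (x # v) = \<tau> (\<gamma> d s (\<pi> x)) # act d s (s (\<pi> x)) v"

definition words :: "nat \<Rightarrow> nat \<Rightarrow> nat list set" where
  "words d n = {w. set w \<subseteq> {1..d} \<and> length w = n}"

definition perm_graph :: "nat \<Rightarrow> (nat \<Rightarrow> nat) set \<Rightarrow> (nat, (nat \<Rightarrow> nat) \<times> nat) mgraph" where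
  "perm_graph d P = action_graph P inv (\<lambda>\<pi> x. \<pi> x) {1..d}"

definition level_graph ::
    "nat \<Rightarrow> (nat \<Rightarrow> nat) set \<Rightarrow> (nat \<Rightarrow> symbol) \<Rightarrow> nat \<Rightarrow> (nat list, symbol \<times> nat list) mgraph" where
  "level_graph d P s n = action_graph (P \<times> P) symbol_inv (act d s) (words d n)"

text \<open>The edge that \<open>s x\<close> gives at \<open>v\<close> is labeled \<open>x\<close> at \<open>v\<close>.\<close>

definition level_label :: "nat \<Rightarrow> (nat \<Rightarrow> symbol) \<Rightarrow> symbol \<times> nat list \<Rightarrow> nat" where
  "level_label d s = (\<lambda>(t, v). inv_into {1..d} s t)"

end

theory Submission
  imports Defs
begin

text \<open>
  A dart of the zig-zag product is a path \<open>x - x'\<close>, \<open>v - u\<close>, \<open>y' - y\<close> in which the middle step forces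
  \<open>y' = \<gamma> x'\<close>. So it is determined by its origin \<open>xv\<close>, the permutation \<open>\<pi>\<close> with \<open>x' = \<pi> x\<close>, and the
  permutation \<open>\<tau>\<close> with \<open>y = \<tau> y'\<close>. Then \<open>u = s\<^bsub>\<pi> x\<^esub> v\<close>, so the path ends at
  \<open>\<tau> (\<gamma> (\<pi> x)) s\<^bsub>\<pi> x\<^esub> v\<close>, which is the image of \<open>xv\<close> under \<open>s\<^bsub>(\<pi>,\<tau>)\<^esub>\<close>.
\<close>

section \<open>Degrees of action graphs\<close>

lemma symbol_inv_Pair: "symbol_inv (\<pi>, \<tau>) = (inv \<tau>, inv \<pi>)"
  by (simp add: symbol_inv_def)

lemma darts_at_action_graph:
  "v \<in> V \<Longrightarrow> darts_at (action_graph S i a V) v = S \<times> {v}"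
  by (auto simp: darts_at_def action_graph_def)

text \<open>The darts at \<open>v\<close> are the pairs \<open>(t, v)\<close>, one for each formal
  generator, so loops and multiple edges do not change the count. Since \<open>i t\<close> acts on
  \<open>V\<close> as the inverse of \<open>t\<close>, flipping a dart twice gives it back.\<close>

lemma regular_action_graph:
  assumes "finite S"
    and "\<And>t. t \<in> S \<Longrightarrow> i t \<in> S \<and> i (i t) = t"
    and "\<And>t v. t \<in> S \<Longrightarrow> v \<in> V \<Longrightarrow> a t v \<in> V \<and> a (i t) (a t v) = v"
  shows "regular (card S) (action_graph S i a V)"
  unfolding regular_def
proof
  show "multigraph (action_graph S i a V)"
    using assms(2,3) by (auto simp: multigraph_def action_graph_def)
  show "\<forall>v\<in>verts (action_graph S i a V). finite (darts_at (action_graph S i a V) v) \<and>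
      card (darts_at (action_graph S i a V) v) = card S"
    using assms(1) by (auto simp: action_graph_def darts_at_action_graph[unfolded action_graph_def]
        card_cartesian_product)
qed

text \<open>Generators are counted as pairs in \<open>P \<times> P\<close>, so two symbols that act
  alike remain distinct. The map \<open>s\<close> is the chosen order on them, and
  \<open>inv_into {1..d} s\<close> gives the index of a symbol.\<close>

locale wreath_recursion =
  fixes d :: nat and P :: "(nat \<Rightarrow> nat) set" and s :: "nat \<Rightarrow> symbol"
  assumes permutes: "\<pi> \<in> P \<Longrightarrow> \<pi> permutes {1..d}"
    and inv_closed: "\<pi> \<in> P \<Longrightarrow> inv \<pi> \<in> P"
    and symbols: "bij_betw s {1..d} (P \<times> P)"
begin

section \<open>Formal symbols, their indices and the involution\<close>

lemma finite_P: "finite P"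
  using finite_permutations[of "{1..d}"] permutes by (metis finite_atLeastAtMost finite_subset
      mem_Collect_eq subsetI)

lemma perm_closed: "\<pi> \<in> P \<Longrightarrow> x \<in> {1..d} \<Longrightarrow> \<pi> x \<in> {1..d}"
  using permutes permutes_in_image by metis

lemma inv_perm:
  assumes "\<pi> \<in> P"
  shows "inv \<pi> (\<pi> x) = x" "\<pi> (inv \<pi> x) = x" "inv (inv \<pi>) = \<pi>"
  using permutes_inverses[OF permutes[OF assms]] permutes_inv_inv[OF permutes[OF assms]] by auto

lemma symbol_in: "x \<in> {1..d} \<Longrightarrow> s x \<in> P \<times> P"
  using symbols bij_betwE by blast

lemma index_symbol: "x \<in> {1..d} \<Longrightarrow> inv_into {1..d} s (s x) = x"
  using symbols by (simp add: bij_betw_def)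

lemma index_in: "t \<in> P \<times> P \<Longrightarrow> inv_into {1..d} s t \<in> {1..d}"
  using symbols by (metis bij_betw_def inv_into_into)

lemma symbol_index: "t \<in> P \<times> P \<Longrightarrow> s (inv_into {1..d} s t) = t"
  using symbols by (metis bij_betw_inv_into_right)

lemma symbol_inv_closed: "t \<in> P \<times> P \<Longrightarrow> symbol_inv t \<in> P \<times> P"
  using inv_closed by (auto simp: symbol_inv_def)

lemma symbol_inv_symbol_inv: "t \<in> P \<times> P \<Longrightarrow> symbol_inv (symbol_inv t) = t"
  using inv_perm by (auto simp: symbol_inv_def)

lemma gamma_in: "x \<in> {1..d} \<Longrightarrow> \<gamma> d s x \<in> {1..d}"
  using index_in[OF symbol_inv_closed[OF symbol_in]] by (simp add: \<gamma>_def)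

lemma symbol_gamma: "x \<in> {1..d} \<Longrightarrow> s (\<gamma> d s x) = symbol_inv (s x)"
  using symbol_index[OF symbol_inv_closed[OF symbol_in]] by (simp add: \<gamma>_def)

text \<open>Formal inversion of symbols is an involution, and \<gamma> is this inversion transported
  to indices along \<open>s\<close>.\<close>

lemma gamma_gamma: "x \<in> {1..d} \<Longrightarrow> \<gamma> d s (\<gamma> d s x) = x"
  by (metis gamma_in symbol_gamma symbol_inv_symbol_inv symbol_in index_symbol)

lemma index_symbol_inv: "t \<in> P \<times> P \<Longrightarrow>
    inv_into {1..d} s (symbol_inv t) = \<gamma> d s (inv_into {1..d} s t)"
  using index_in symbol_index by (simp add: \<gamma>_def)

section \<open>The action on words\<close>

lemma words_Suc: "w \<in> words d (Suc n) \<longleftrightarrow> (\<exists>x v. w = x # v \<and> x \<in> {1..d} \<and> v \<in> words d n)"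
  by (cases w) (auto simp: words_def)

lemma act_closed: "t \<in> P \<times> P \<Longrightarrow> v \<in> words d n \<Longrightarrow> act d s t v \<in> words d n"
\<comment> \<open>The symbol must vary in the induction, because the tail is acted on by
  \<open>s (\<pi> x)\<close> instead of \<open>t\<close>.\<close>
proof (induction n arbitrary: t v)
  case 0
  then show ?case by (cases t) (auto simp: words_def)
next
  case (Suc n)
  obtain \<pi> \<tau> x w where eq: "t = (\<pi>, \<tau>)" "v = x # w" and "\<pi> \<in> P" "\<tau> \<in> P" "x \<in> {1..d}"
    and w: "w \<in> words d n"
    using Suc.prems by (auto simp: words_Suc)
  then have "\<pi> x \<in> {1..d}" "\<tau> (\<gamma> d s (\<pi> x)) \<in> {1..d}"
    using perm_closed gamma_in by blast+
  then show ?case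
    using Suc.IH[OF symbol_in w] unfolding eq words_Suc by simp
qed

text \<open>The first letter of the image of \<open>x # w\<close> is
  \<open>\<tau> (\<gamma> d s (\<pi> x))\<close>. Applying \<open>inv \<tau>\<close>, then \<gamma>,
  then \<open>inv \<pi>\<close> brings back \<open>x\<close>. Meanwhile the tail meets the symbol
  with index \<open>\<gamma> d s (\<pi> x)\<close>, which is the formal inverse of
  \<open>s (\<pi> x)\<close>, so the induction hypothesis restores \<open>w\<close>.\<close>

lemma act_symbol_inv: "t \<in> P \<times> P \<Longrightarrow> v \<in> words d n \<Longrightarrow> act d s (symbol_inv t) (act d s t v) = v"
proof (induction n arbitrary: t v)
  case 0
  then show ?case by (cases t) (auto simp: words_def symbol_inv_def)
next
  case (Suc n)
  obtain \<pi> \<tau> x w where eq: "t = (\<pi>, \<tau>)" "v = x # w" and P: "\<pi> \<in> P" "\<tau> \<in> P" and "x \<in> {1..d}"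
    and w: "w \<in> words d n"
    using Suc.prems by (auto simp: words_Suc)
  then have "\<pi> x \<in> {1..d}"
    using perm_closed by blast
  then show ?case
    using Suc.IH[OF symbol_in w] P
    by (simp add: eq symbol_inv_Pair inv_perm gamma_gamma symbol_gamma
        del: atLeastAtMost_iff)
qed

section \<open>Regularity and the edge labeling\<close>

lemma regular_perm_graph: "regular (card P) (perm_graph d P)"
  unfolding perm_graph_def
  using finite_P inv_closed perm_closed inv_perm by (intro regular_action_graph) simp_all

lemma regular_level_graph: "regular (card (P \<times> P)) (level_graph d P s n)"
  unfolding level_graph_def
  using finite_P symbol_inv_closed symbol_inv_symbol_inv act_closed act_symbol_inv
  by (intro regular_action_graph) blast+

lemma darts_at_level_graph:
  "v \<in> words d n \<Longrightarrow> darts_at (level_graph d P s n) v = (P \<times> P) \<times> {v}"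
  by (simp add: level_graph_def darts_at_action_graph)

lemma edge_labeling_level_graph:
  "edge_labeling (level_graph d P s n) (level_label d s) {1..d}"
  unfolding edge_labeling_def
proof
  fix v
  assume "v \<in> verts (level_graph d P s n)"
  then have "v \<in> words d n"
    by (simp add: level_graph_def action_graph_def)
  moreover have "bij_betw (level_label d s) ((P \<times> P) \<times> {v}) {1..d}"
  \<comment> \<open>The dart at \<open>v\<close> with label \<open>x\<close> is the one given by the
    symbol of index \<open>x\<close>.\<close>
  proof (rule bij_betw_byWitness[where f' = "\<lambda>x. (s x, v)"])
    show "(\<lambda>x. (s x, v)) ` {1..d} \<subseteq> (P \<times> P) \<times> {v}"
      using symbol_in by blast
    show "level_label d s ` ((P \<times> P) \<times> {v}) \<subseteq> {1..d}"
      using index_in by (auto simp: level_label_def simp del: atLeastAtMost_iff)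
  qed (use symbol_index index_symbol in \<open>auto simp: level_label_def\<close>)
  ultimately show "bij_betw (level_label d s) (darts_at (level_graph d P s n) v) {1..d}"
    by (simp add: darts_at_level_graph)
qed

lemma neighbor_level_graph:
  assumes "v \<in> words d n" and "x \<in> {1..d}"
  shows "neighbor (level_graph d P s n) (level_label d s) v x = act d s (s x) v"
proof -
  have "(THE e. e \<in> darts_at (level_graph d P s n) v \<and> level_label d s e = x) = (s x, v)"
  proof (rule the_equality)
    show "(s x, v) \<in> darts_at (level_graph d P s n) v \<and> level_label d s (s x, v) = x"
      using index_symbol[OF assms(2)] symbol_in[OF assms(2)]
      by (simp add: darts_at_level_graph[OF assms(1)] level_label_def)
  next
    fix e
    assume "e \<in> darts_at (level_graph d P s n) v \<and> level_label d s e = x"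
    then have e: "e \<in> (P \<times> P) \<times> {v}" "inv_into {1..d} s (fst e) = x"
      by (simp_all only: darts_at_level_graph[OF assms(1)] level_label_def case_prod_beta)
    then have "fst e \<in> P \<times> P" "snd e = v"
      by (simp_all only: mem_Times_iff singleton_iff)
    then show "e = (s x, v)"
      using symbol_index[of "fst e"] e(2) by (simp add: prod_eq_iff)
  qed
  then show ?thesis
    by (simp add: neighbor_def terminus_def level_graph_def action_graph_def split: prod.splits)
qed

text \<open>A flip replaces the symbol of a dart by its formal inverse, and on indices this is
  \<gamma>. Hence the third step of a zig-zag path starts at the \<gamma>-image of the vertex where
  the first step ends.\<close>

lemma level_label_flip:
  assumes "e \<in> darts (level_graph d P s n)"
  shows "level_label d s (flip (level_graph d P s n) e) = \<gamma> d s (level_label d s e)"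
  using assms index_symbol_inv by (auto simp: level_graph_def action_graph_def level_label_def)

section \<open>Darts of the next level as zig-zag paths\<close>

definition zigzag_path where
  "zigzag_path = (\<lambda>((\<pi>, \<tau>), w). ((\<pi>, hd w), (s (\<pi> (hd w)), tl w), (\<tau>, \<gamma> d s (\<pi> (hd w)))))"

text \<open>The inverse map may drop the middle symbol \<open>t\<close> and the vertex
  \<open>y\<close>, since the two incidence conditions on a path recover both from
  \<open>\<pi>\<close> and \<open>x\<close>.\<close>

lemma bij_betw_zigzag_path:
  "bij_betw zigzag_path (darts (level_graph d P s (Suc n)))
    (darts (zigzag (level_graph d P s n) (level_label d s) (perm_graph d P)))"
  (is "bij_betw _ ?A ?B")
proof (rule bij_betw_byWitness[where f' = "\<lambda>((\<pi>, x), (t, v), (\<tau>, y)). ((\<pi>, \<tau>), x # v)"])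
  \<comment> \<open>The conditions that the three steps fit together are solved for \<open>t\<close>
    and \<open>y\<close>: the first fixes the index of \<open>t\<close>, the second then gives
    \<open>y\<close> by \<gamma>.\<close>
  have path: "\<pi> x = inv_into {1..d} s t \<and> inv_into {1..d} s (symbol_inv t) = y \<longleftrightarrow>
      t = s (\<pi> x) \<and> y = \<gamma> d s (\<pi> x)"
    if "\<pi> \<in> P" "x \<in> {1..d}" "t \<in> P \<times> P" for \<pi> x t y
    using index_symbol_inv[OF that(3)] symbol_index[OF that(3)]
      index_symbol[OF perm_closed[OF that(1,2)]] by metis
  have "?B = {((\<pi>, x), (t, v), (\<tau>, y)). \<pi> \<in> P \<and> x \<in> {1..d} \<and> t \<in> P \<times> P \<and> v \<in> words d n \<and>
      \<tau> \<in> P \<and> y \<in> {1..d} \<and> \<pi> x = inv_into {1..d} s t \<and> inv_into {1..d} s (symbol_inv t) = y}"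
    by (auto simp: zigzag_def level_graph_def perm_graph_def action_graph_def terminus_def
        level_label_def simp del: atLeastAtMost_iff)
  also have "\<dots> = {((\<pi>, x), (t, v), (\<tau>, y)). \<pi> \<in> P \<and> x \<in> {1..d} \<and> t \<in> P \<times> P \<and> v \<in> words d n \<and>
      \<tau> \<in> P \<and> y \<in> {1..d} \<and> t = s (\<pi> x) \<and> y = \<gamma> d s (\<pi> x)}"
    \<comment> \<open>The equivalence holds only for arguments in \<open>P\<close>,
      \<open>{1..d}\<close> and \<open>P \<times> P\<close>; the congruence rule supplies these
      memberships from the preceding conjuncts.\<close>
    using path by (simp cong: conj_cong del: atLeastAtMost_iff mem_Sigma_iff)
  finally have B: "?B = \<dots>" .
  \<comment> \<open>Words of length \<open>Suc n\<close> are written as \<open>x # v\<close>, so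
    that \<open>hd\<close> and \<open>tl\<close> in \<open>zigzag_path\<close> evaluate.\<close>
  have A: "?A = {((\<pi>, \<tau>), w). \<pi> \<in> P \<and> \<tau> \<in> P \<and>
      (\<exists>x v. w = x # v \<and> x \<in> {1..d} \<and> v \<in> words d n)}"
    by (auto simp: level_graph_def action_graph_def words_Suc simp del: atLeastAtMost_iff)
  show "\<forall>a\<in>?A. (\<lambda>((\<pi>, x), (t, v), (\<tau>, y)). ((\<pi>, \<tau>), x # v)) (zigzag_path a) = a"
    unfolding A by (auto simp: zigzag_path_def)
  show "\<forall>b\<in>?B. zigzag_path ((\<lambda>((\<pi>, x), (t, v), (\<tau>, y)). ((\<pi>, \<tau>), x # v)) b) = b"
    unfolding B by (auto simp: zigzag_path_def)
  show "zigzag_path ` ?A \<subseteq> ?B"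
  proof (rule image_subsetI)
    fix a
    assume "a \<in> ?A"
    then obtain \<pi> \<tau> x v where a: "a = ((\<pi>, \<tau>), x # v)" "\<pi> \<in> P" "\<tau> \<in> P" "x \<in> {1..d}"
      "v \<in> words d n"
      unfolding A by blast
    then have "\<pi> x \<in> {1..d}"
      using perm_closed by blast
    then show "zigzag_path a \<in> ?B"
      using a symbol_in gamma_in unfolding B
      by (simp add: zigzag_path_def del: atLeastAtMost_iff mem_Sigma_iff)
  qed
  show "(\<lambda>((\<pi>, x), (t, v), (\<tau>, y)). ((\<pi>, \<tau>), x # v)) ` ?B \<subseteq> ?A"
    unfolding A B by (auto simp del: atLeastAtMost_iff)
qed

text \<open>The reversed path starts at \<open>\<tau> (\<gamma> d s (\<pi> x))\<close>, goes by
  \<open>inv \<tau>\<close> to \<open>\<gamma> d s (\<pi> x)\<close>, follows the inverse middle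
  edge to label \<open>\<pi> x\<close> and ends with \<open>inv \<pi>\<close>. This is the path of
  the symbol \<open>(inv \<tau>, inv \<pi>)\<close> at the image of \<open>x # v\<close>.\<close>

lemma flip_zigzag_path:
  assumes "e \<in> darts (level_graph d P s (Suc n))"
  shows "flip (zigzag (level_graph d P s n) (level_label d s) (perm_graph d P)) (zigzag_path e) =
    zigzag_path (flip (level_graph d P s (Suc n)) e)"
proof -
  obtain \<pi> \<tau> x v where e: "e = ((\<pi>, \<tau>), x # v)" and P: "\<pi> \<in> P" "\<tau> \<in> P" and "x \<in> {1..d}"
    using assms by (auto simp: level_graph_def action_graph_def words_Suc)
  then have "\<pi> x \<in> {1..d}"
    using perm_closed by blast
  then show ?thesis
    using P by (simp add: e zigzag_path_def zigzag_def level_graph_def perm_graph_def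
        action_graph_def symbol_inv_Pair inv_perm gamma_gamma symbol_gamma
        del: atLeastAtMost_iff)
qed

lemma origin_zigzag_path:
  assumes "e \<in> darts (level_graph d P s (Suc n))"
  shows "(\<lambda>(x, v). x # v)
      (origin (zigzag (level_graph d P s n) (level_label d s) (perm_graph d P)) (zigzag_path e)) =
    origin (level_graph d P s (Suc n)) e"
  using assms by (auto simp: zigzag_path_def zigzag_def level_graph_def perm_graph_def
      action_graph_def words_Suc)

lemma verts_level_graph_Suc:
  "verts (level_graph d P s (Suc n)) =
    (\<lambda>(x, v). x # v) ` verts (zigzag (level_graph d P s n) (level_label d s) (perm_graph d P))"
  by (force simp: zigzag_def level_graph_def perm_graph_def action_graph_def words_Suc)

text \<open>Compatibility with origins and flips also matches the far ends of edges and the kinds of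
  loops.\<close>

lemma level_graph_Suc_eq_zigzag:
  "graph_eq (level_graph d P s (Suc n))
    (rename_verts (\<lambda>(x, v). x # v)
      (zigzag (level_graph d P s n) (level_label d s) (perm_graph d P)))"
  unfolding graph_eq_def rename_verts_def
  using bij_betw_zigzag_path[of n]
  by (intro conjI exI[of _ zigzag_path])
    (simp_all add: flip_zigzag_path origin_zigzag_path verts_level_graph_Suc)

end

theorem theorem1:
  fixes d n :: nat and P :: "(nat \<Rightarrow> nat) set" and s :: "nat \<Rightarrow> symbol"
  assumes "\<And>\<pi>. \<pi> \<in> P \<Longrightarrow> \<pi> permutes {1..d}"
    and "\<And>\<pi>. \<pi> \<in> P \<Longrightarrow> inv \<pi> \<in> P"
    and "d = (card P)\<^sup>2"
    and "bij_betw s {1..d} (P \<times> P)"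
    and "n \<ge> 1"
  shows "regular (card P) (perm_graph d P) \<and>
    regular d (level_graph d P s n) \<and>
    edge_labeling (level_graph d P s n) (level_label d s) (verts (perm_graph d P)) \<and>
    (\<forall>v\<in>words d n. \<forall>x\<in>{1..d}.
       neighbor (level_graph d P s n) (level_label d s) v x = act d s (s x) v) \<and>
    (\<forall>e\<in>darts (level_graph d P s n).
       level_label d s (flip (level_graph d P s n) e) = \<gamma> d s (level_label d s e)) \<and>
    graph_eq (level_graph d P s (Suc n))
      (rename_verts (\<lambda>(x, v). x # v)
        (zigzag (level_graph d P s n) (level_label d s) (perm_graph d P)))"
proof -
  interpret wreath_recursion d P s
    by unfold_locales (use assms(1,2,4) in auto)
  \<comment> \<open>The degree of the level graph, counted in formal symbols, becomes
    \<open>d\<close>.\<close>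
  have "card (P \<times> P) = d"
    using assms(3) by (simp add: card_cartesian_product power2_eq_square)
  \<comment> \<open>The labels in \<open>{1..d}\<close> are thus the vertices of the second factor,
    as the zig-zag product requires.\<close>
  moreover have "verts (perm_graph d P) = {1..d}"
    by (simp add: perm_graph_def action_graph_def)
  ultimately show ?thesis
    using regular_perm_graph regular_level_graph[of n] edge_labeling_level_graph[of n]
      level_graph_Suc_eq_zigzag[of n]
    by (simp add: neighbor_level_graph level_label_flip del: atLeastAtMost_iff)
qed

end
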